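(* Let $G$ be a hyperlinear group and let $H$ be an amenable group. Then the unrestricted wreath product $G\wr\wr H$ is hyperlinear.
   Context: All groups are discrete groups; no countability or finite generation is assumed. **Unrestricted wreath product.** For groups $G$ and $H$, the unrestricted wreath product is the semi-direct product $G\wr\wr H:=\bigl(\prod_{h\in H}G\bigr)\rtimes H$, where the full direct product (all functions $H\to G$) is used and $H$ acts by shifting coordinates. Explicitly, its elements are the pairs $\bigl((g_x)_{x\in H},h\bigr)$ with $g_x\in G$ for every $x\in H$ and $h\in H$, and the multiplication is $$\bigl((g_x)_{x\in H},h\bigr)\cdot\bigl((g'_x)_{x\in H},h'\bigr)=\bigl((g_{h'x}\,g'_x)_{x\in H},\,hh'\bigr).$$ **Normalised Hilbert–Schmidt distance.** Let $\mathcal{U}(\mathbb{C}^n)$ be the group of unitary $n\times n$ complex matrices, $n\geqslant 1$. For $u=(u_{i,j})$, $v=(v_{i,j})\in\mathcal{U}(\mathbb{C}^n)$, put $$d_{HS}(u,v):=\sqrt{\frac1n\sum_{i,j=1}^n|u_{i,j}-v_{i,j}|^2}.$$ **Hyperlinear group.** A group $G$ is hyperlinear if for every finite subset $K\subseteq G$ and every $\varepsilon>0$ there exist a natural number $n\geqslant 1$ and a map $\vartheta\colon G\to\mathcal{U}(\mathbb{C}^n)$ such that: (h1) for all $k_1,k_2\in K$, $d_{HS}\bigl(\vartheta(k_1)\vartheta(k_2),\vartheta(k_1k_2)\bigr)\leqslant\varepsilon$; (h2) for all distinct $k_1,k_2\in K$, $d_{HS}\bigl(\vartheta(k_1),\vartheta(k_2)\bigr)\geqslant\sqrt2-\varepsilon$.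 **Amenable group.** A group $H$ is amenable if it satisfies the Følner condition: for every finite subset $S\subseteq H$ and every $\varepsilon>0$ there is a non-empty finite subset $F\subseteq H$ with $|F\setminus sF|<\varepsilon|F|$ for all $s\in S$. *)

theory Defs
  imports "HOL-Analysis.Analysis" "HOL-Algebra.Coset"
    "Jordan_Normal_Form.Schur_Decomposition"
begin

definition unrestricted_wreath ::
  "('a, 'm) monoid_scheme \<Rightarrow> ('b, 'n) monoid_scheme \<Rightarrow> (('b \<Rightarrow> 'a) \<times> 'b) monoid"
  where "unrestricted_wreath G H =
    \<lparr>carrier = (carrier H \<rightarrow>\<^sub>E carrier G) \<times> carrier H,
     mult = (\<lambda>(g, h) (g', h').
       (\<lambda>x\<in>carrier H. g (h' \<otimes>\<^bsub>H\<^esub> x) \<otimes>\<^bsub>G\<^esub> g' x, h \<otimes>\<^bsub>H\<^esub> h')),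
     one = (\<lambda>x\<in>carrier H. \<one>\<^bsub>G\<^esub>, \<one>\<^bsub>H\<^esub>)\<rparr>"

lemma group_unrestricted_wreath:
  fixes G :: "('a, 'm) monoid_scheme" and H :: "('b, 'n) monoid_scheme"
  assumes "group G" and "group H"
  shows "group (unrestricted_wreath G H)"
proof -
  interpret G: group G by fact
  interpret H: group H by fact
  have val: "g x \<in> carrier G" if "g \<in> carrier H \<rightarrow>\<^sub>E carrier G" "x \<in> carrier H" for g x
    using that by (rule PiE_mem)
  have ext: "g \<in> extensional (carrier H)" if "g \<in> carrier H \<rightarrow>\<^sub>E carrier G" for g
    using that by (simp add: PiE_def)
  show ?thesis
  proof (rule groupI)
    fix p
    assume "p \<in> carrier (unrestricted_wreath G H)"
    then obtain g h where p: "p = (g, h)" "g \<in> carrier H \<rightarrow>\<^sub>E carrier G" "h \<in> carrier H"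
      by (auto simp: unrestricted_wreath_def)
    define q where "q = (\<lambda>x\<in>carrier H. inv\<^bsub>G\<^esub> g (inv\<^bsub>H\<^esub> h \<otimes>\<^bsub>H\<^esub> x), inv\<^bsub>H\<^esub> h)"
    have "q \<in> carrier (unrestricted_wreath G H)"
      using p by (auto simp: q_def unrestricted_wreath_def)
    moreover have "q \<otimes>\<^bsub>unrestricted_wreath G H\<^esub> p = \<one>\<^bsub>unrestricted_wreath G H\<^esub>"
      using p by (auto simp: q_def unrestricted_wreath_def H.m_assoc[symmetric] val
          intro!: restrict_ext)
    ultimately show "\<exists>q\<in>carrier (unrestricted_wreath G H).
        q \<otimes>\<^bsub>unrestricted_wreath G H\<^esub> p = \<one>\<^bsub>unrestricted_wreath G H\<^esub>"
      by blast
  qed (auto simp: unrestricted_wreath_def G.m_assoc H.m_assoc val ext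
      intro!: restrict_ext extensionalityI[of _ "carrier H"])
qed

definition unitary_mats :: "nat \<Rightarrow> complex mat set"
  where "unitary_mats n =
    {u \<in> carrier_mat n n. mat_adjoint u * u = 1\<^sub>m n \<and> u * mat_adjoint u = 1\<^sub>m n}"

definition hs_dist :: "nat \<Rightarrow> complex mat \<Rightarrow> complex mat \<Rightarrow> real"
  where "hs_dist n u v =
    sqrt (1 / real n * (\<Sum>i<n. \<Sum>j<n. (cmod (u $$ (i, j) - v $$ (i, j)))\<^sup>2))"

definition hyperlinear_group :: "('a, 'm) monoid_scheme \<Rightarrow> bool"
  where "hyperlinear_group G \<longleftrightarrow> group G \<and>
    (\<forall>K \<epsilon>. finite K \<and> K \<subseteq> carrier G \<and> 0 < \<epsilon> \<longrightarrow>
      (\<exists>n \<theta>. 1 \<le> n \<and> \<theta> \<in> carrier G \<rightarrow> unitary_mats n \<and>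
        (\<forall>k\<^sub>1\<in>K. \<forall>k\<^sub>2\<in>K. hs_dist n (\<theta> k\<^sub>1 * \<theta> k\<^sub>2) (\<theta> (k\<^sub>1 \<otimes>\<^bsub>G\<^esub> k\<^sub>2)) \<le> \<epsilon>) \<and>
        (\<forall>k\<^sub>1\<in>K. \<forall>k\<^sub>2\<in>K. k\<^sub>1 \<noteq> k\<^sub>2 \<longrightarrow> hs_dist n (\<theta> k\<^sub>1) (\<theta> k\<^sub>2) \<ge> sqrt 2 - \<epsilon>)))"

definition amenable_group :: "('a, 'm) monoid_scheme \<Rightarrow> bool"
  where "amenable_group H \<longleftrightarrow> group H \<and>
    (\<forall>S \<epsilon>. finite S \<and> S \<subseteq> carrier H \<and> (0::real) < \<epsilon> \<longrightarrow>
      (\<exists>F. finite F \<and> F \<noteq> {} \<and> F \<subseteq> carrier H \<and>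
        (\<forall>s\<in>S. real (card (F - (s <#\<^bsub>H\<^esub> F))) < \<epsilon> * real (card F))))"

end

theory Submission
  imports Defs "HOL-Algebra.Product_Groups"
begin

text \<open>
  Write \<open>e\<^sub>f\<close> for the basis vectors of \<open>\<complex>\<^sup>F\<close>, where \<open>F\<close> is a Folner set of \<open>H\<close>, and let \<open>\<sigma>\<close> be an
  approximate representation of the base group \<open>N = G\<^sup>H\<close>. Since \<open>(g, h) (1, f) = (1, hf) (g(f \<cdot>), 1)\<close>,
  the representation of the wreath product induced from \<open>\<sigma>\<close> sends \<open>e\<^sub>f \<otimes> v\<close> to
  \<open>e\<^bsub>hf\<^esub> \<otimes> \<sigma>(g(f \<cdot>)) v\<close>. On the finite set \<open>F\<close> this is repaired by extending the partial injection
  \<open>f \<mapsto> hf\<close> to a permutation of \<open>F\<close>; the result is a block permutation unitary, and the repair touches only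
  a small fraction of \<open>F\<close>. If \<open>h \<noteq> h'\<close> then \<open>hf \<noteq> h'f\<close>, so the blocks of \<open>(g, h)\<close> and \<open>(g', h')\<close> are almost
  everywhere in different positions and the two unitaries are almost orthogonal. If \<open>h = h'\<close> and
  \<open>g \<noteq> g'\<close> then the translates \<open>g(f \<cdot>)\<close> and \<open>g'(f \<cdot>)\<close> differ for every \<open>f\<close>, so every block is handled by \<open>\<sigma>\<close>.
  The set \<open>F\<close> is chosen before \<open>\<sigma>\<close>, so \<open>\<sigma>\<close> has to be good only on finitely many elements of \<open>N\<close>,
  although these are arbitrary functions on \<open>H\<close>.

  It remains to see that \<open>G\<^sup>X\<close> is hyperlinear for every set \<open>X\<close> (\<open>hyperlinear_direct_power\<close>). Finitely many
  functions are separated by a finite set \<open>S\<close> of coordinates. The direct sum \<open>1 \<oplus> \<Oplus>\<^bsub>s\<in>S\<^esub> \<theta>(g(s))\<close> separates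
  them a little: the normalised trace inner product of two values is an average of numbers in the
  unit disc, one of which is 1 and another of which has small or negative real part, hence its modulus is
  at most some \<open>c < 1\<close> that depends on \<open>S\<close> only. In the \<open>m\<close>-th tensor power the inner product is raised to the
  \<open>m\<close>-th power and becomes as small as desired. The summand 1 is essential: orthogonality in the real part alone
  allows the inner product \<open>-1\<close>, which tensor powers do not improve.

  Distances enter only through \<open>d(u, v)\<^sup>2 = 2 - 2 Re \<langle>u, v\<rangle>\<close>, valid for unitaries. The constructions
  are carried out for matrices indexed by arbitrary finite sets, so that direct sums and tensor powers are
  indexed by pairs and by functions; numbering of the index set happens once, in
  \<open>hyperlinear_if_approx_reps\<close>.
\<close>

section \<open>Matrices indexed by finite sets\<close>

text \<open>
  A matrix over a finite index set \<open>I\<close> is a function of two arguments of which only the values on \<open>I \<times> I\<close>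
  matter. Total functions are used so that no restriction has to be carried through the constructions.
\<close>
definition ix_mult :: "'i set \<Rightarrow> ('i \<Rightarrow> 'i \<Rightarrow> complex) \<Rightarrow> ('i \<Rightarrow> 'i \<Rightarrow> complex) \<Rightarrow> 'i \<Rightarrow> 'i \<Rightarrow> complex"
  where "ix_mult I u v = (\<lambda>i j. \<Sum>k\<in>I. u i k * v k j)"

text \<open>
  The normalised trace of \<open>u\<^sup>* v\<close>.
\<close>
definition ix_inner :: "'i set \<Rightarrow> ('i \<Rightarrow> 'i \<Rightarrow> complex) \<Rightarrow> ('i \<Rightarrow> 'i \<Rightarrow> complex) \<Rightarrow> complex"
  where "ix_inner I u v = (\<Sum>i\<in>I. \<Sum>j\<in>I. cnj (u i j) * v i j) / of_nat (card I)"

text \<open>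
  Orthonormality of the columns. For square matrices this is unitarity
  (\<open>unitary_mats_iff_isometric\<close>), and requiring one side only halves the closure proofs below.
\<close>
definition isometric :: "'i set \<Rightarrow> ('i \<Rightarrow> 'i \<Rightarrow> complex) \<Rightarrow> bool"
  where "isometric I u \<longleftrightarrow> (\<forall>i\<in>I. \<forall>j\<in>I. (\<Sum>k\<in>I. cnj (u k i) * u k j) = of_bool (i = j))"

definition ix_one :: "'i \<Rightarrow> 'i \<Rightarrow> complex"
  where "ix_one = (\<lambda>i j. of_bool (i = j))"

lemma isometricD:
  "isometric I u \<Longrightarrow> i \<in> I \<Longrightarrow> j \<in> I \<Longrightarrow> (\<Sum>k\<in>I. cnj (u k i) * u k j) = of_bool (i = j)"
  by (auto simp: isometric_def)

lemma ix_inner_cong: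
  assumes "\<And>i j. i \<in> I \<Longrightarrow> j \<in> I \<Longrightarrow> u i j = u' i j" "\<And>i j. i \<in> I \<Longrightarrow> j \<in> I \<Longrightarrow> v i j = v' i j"
  shows "ix_inner I u v = ix_inner I u' v'"
  unfolding ix_inner_def using assms by (auto intro!: sum.cong arg_cong2[of _ _ _ _ "(/)"])

lemma isometric_ix_one: "finite I \<Longrightarrow> isometric I ix_one"
  by (auto simp: isometric_def ix_one_def of_bool_def if_distrib cong: if_cong)

lemma ix_mult_ix_one: "finite I \<Longrightarrow> i \<in> I \<Longrightarrow> j \<in> I \<Longrightarrow> ix_mult I ix_one ix_one i j = ix_one i j"
  by (auto simp: ix_mult_def ix_one_def of_bool_def if_distrib cong: if_cong)

lemma isometric_ix_mult:
  assumes "finite I" "isometric I u" "isometric I v"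
  shows "isometric I (ix_mult I u v)"
  unfolding isometric_def
proof (intro ballI)
  fix i j assume ij: "i \<in> I" "j \<in> I"
  have "(\<Sum>k\<in>I. cnj (ix_mult I u v k i) * ix_mult I u v k j)
      = (\<Sum>k\<in>I. \<Sum>a\<in>I. \<Sum>b\<in>I. cnj (v a i) * v b j * (cnj (u k a) * u k b))"
    unfolding ix_mult_def cnj_sum sum_product by (intro sum.cong refl) (simp add: mult_ac)
  also have "\<dots> = (\<Sum>a\<in>I. \<Sum>b\<in>I. \<Sum>k\<in>I. cnj (v a i) * v b j * (cnj (u k a) * u k b))"
    by (subst sum.swap) (intro sum.cong refl sum.swap)
  also have "\<dots> = (\<Sum>a\<in>I. \<Sum>b\<in>I. cnj (v a i) * v b j * of_bool (a = b))"
    by (intro sum.cong refl) (simp add: sum_distrib_left[symmetric] isometricD[OF assms(2)])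
  also have "\<dots> = (\<Sum>a\<in>I. cnj (v a i) * v a j)"
    using assms(1) by (simp add: of_bool_def if_distrib cong: if_cong)
  finally show "(\<Sum>k\<in>I. cnj (ix_mult I u v k i) * ix_mult I u v k j) = of_bool (i = j)"
    using isometricD[OF assms(3) ij] by simp
qed

lemma isometric_norm:
  assumes "isometric I u"
  shows "(\<Sum>i\<in>I. \<Sum>j\<in>I. (cmod (u i j))\<^sup>2) = real (card I)"
proof -
  have "complex_of_real (\<Sum>i\<in>I. \<Sum>j\<in>I. (cmod (u i j))\<^sup>2) = (\<Sum>j\<in>I. \<Sum>i\<in>I. cnj (u i j) * u i j)"
    by (subst sum.swap) (simp only: of_real_sum complex_norm_square mult.commute)
  also have "\<dots> = (\<Sum>j\<in>I. 1)"
    by (intro sum.cong refl) (simp add: isometricD[OF assms])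
  also have "\<dots> = complex_of_real (real (card I))"
    by simp
  finally show ?thesis
    by (simp only: of_real_eq_iff)
qed

text \<open>
  Polarisation: an isometric matrix has normalised Hilbert-Schmidt norm 1, so distances and real parts of
  inner products determine each other.
\<close>
lemma hs_square_eq:
  assumes "finite I" "I \<noteq> {}" "isometric I u" "isometric I v"
  shows "(\<Sum>i\<in>I. \<Sum>j\<in>I. (cmod (u i j - v i j))\<^sup>2) / real (card I) = 2 - 2 * Re (ix_inner I u v)"
proof -
  have *: "(cmod (x - y))\<^sup>2 = (cmod x)\<^sup>2 + (cmod y)\<^sup>2 - 2 * Re (cnj x * y)" for x y
    unfolding cmod_power2 by (simp add: power2_eq_square algebra_simps)
  have "Re (ix_inner I u v) = (\<Sum>i\<in>I. \<Sum>j\<in>I. Re (cnj (u i j) * v i j)) / real (card I)"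
    unfolding ix_inner_def by (simp only: Re_divide_of_nat Re_sum)
  moreover have "(\<Sum>i\<in>I. \<Sum>j\<in>I. (cmod (u i j - v i j))\<^sup>2)
     = 2 * real (card I) - 2 * (\<Sum>i\<in>I. \<Sum>j\<in>I. Re (cnj (u i j) * v i j))"
    unfolding * using isometric_norm[OF assms(3)] isometric_norm[OF assms(4)]
    by (simp only: sum.distrib sum_subtractf sum_distrib_left[symmetric])
  ultimately show ?thesis
    using assms(1,2) by (simp add: field_simps)
qed

lemma norm_ix_inner_le_1:
  assumes "finite I" "I \<noteq> {}" "isometric I u" "isometric I v"
  shows "cmod (ix_inner I u v) \<le> 1"
proof -
  have "cmod (\<Sum>i\<in>I. \<Sum>j\<in>I. cnj (u i j) * v i j) \<le> (\<Sum>i\<in>I. \<Sum>j\<in>I. ((cmod (u i j))\<^sup>2 + (cmod (v i j))\<^sup>2) / 2)"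
  proof (intro sum_norm_le)
    fix i j
    have "0 \<le> (cmod (u i j) - cmod (v i j))\<^sup>2" by simp
    then show "cmod (cnj (u i j) * v i j) \<le> ((cmod (u i j))\<^sup>2 + (cmod (v i j))\<^sup>2) / 2"
      by (simp add: norm_mult power2_diff)
  qed
  also have "\<dots> = real (card I)"
    using isometric_norm[OF assms(3)] isometric_norm[OF assms(4)]
    by (simp add: sum.distrib sum_divide_distrib[symmetric])
  finally show ?thesis
    using assms(1,2) by (simp add: ix_inner_def norm_divide divide_le_eq)
qed

section \<open>Tensor powers\<close>

text \<open>
  The \<open>m\<close>-fold tensor power, with index set \<open>{..<m} \<rightarrow>\<^sub>E I\<close>. Its algebra is one identity, the
  distributive law for a product of sums.
\<close>
definition ix_power :: "nat \<Rightarrow> ('i \<Rightarrow> 'i \<Rightarrow> complex) \<Rightarrow> (nat \<Rightarrow> 'i) \<Rightarrow> (nat \<Rightarrow> 'i) \<Rightarrow> complex"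
  where "ix_power m u = (\<lambda>a b. \<Prod>l<m. u (a l) (b l))"

lemma ix_mult_ix_power:
  assumes "finite I"
  shows "ix_mult ({..<m} \<rightarrow>\<^sub>E I) (ix_power m u) (ix_power m v) = ix_power m (ix_mult I u v)"
  unfolding ix_mult_def ix_power_def prod.distrib[symmetric]
  using assms by (intro ext prod_sum_PiE[symmetric]) auto

lemma isometric_ix_power:
  assumes "finite I" "isometric I u"
  shows "isometric ({..<m} \<rightarrow>\<^sub>E I) (ix_power m u)"
  unfolding isometric_def
proof (intro ballI)
  fix a b assume ab: "a \<in> {..<m} \<rightarrow>\<^sub>E I" "b \<in> {..<m} \<rightarrow>\<^sub>E I"
  have "(\<Sum>c\<in>{..<m} \<rightarrow>\<^sub>E I. cnj (ix_power m u c a) * ix_power m u c b)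
      = (\<Prod>l<m. \<Sum>k\<in>I. cnj (u k (a l)) * u k (b l))"
    unfolding ix_power_def cnj_prod prod.distrib[symmetric]
    using assms(1) by (intro prod_sum_PiE[symmetric]) auto
  also have "\<dots> = (\<Prod>l<m. of_bool (a l = b l))"
    using ab by (intro prod.cong refl isometricD[OF assms(2)]) auto
  also have "\<dots> = of_bool (a = b)"
  proof (cases "a = b")
    case False
    then obtain l where "l < m" "a l \<noteq> b l"
      using ab by (metis PiE_ext lessThan_iff)
    then show ?thesis using False by (auto intro!: prod_zero)
  qed simp
  finally show "(\<Sum>c\<in>{..<m} \<rightarrow>\<^sub>E I. cnj (ix_power m u c a) * ix_power m u c b) = of_bool (a = b)" .
qed

lemma ix_inner_ix_power:
  assumes "finite I"
  shows "ix_inner ({..<m} \<rightarrow>\<^sub>E I) (ix_power m u) (ix_power m v) = ix_inner I u v ^ m"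
proof -
  have "(\<Sum>i\<in>I. \<Sum>j\<in>I. cnj (u i j) * v i j) ^ m = (\<Prod>l<m. \<Sum>i\<in>I. \<Sum>j\<in>I. cnj (u i j) * v i j)"
    by simp
  also have "\<dots> = (\<Sum>a\<in>{..<m} \<rightarrow>\<^sub>E I. \<Sum>b\<in>{..<m} \<rightarrow>\<^sub>E I. cnj (ix_power m u a b) * ix_power m v a b)"
    unfolding ix_power_def cnj_prod prod.distrib[symmetric]
    by (simp only: prod_sum_PiE assms finite_lessThan)
  finally show ?thesis
    by (simp add: ix_inner_def card_PiE power_divide)
qed

section \<open>Block permutation matrices\<close>

text \<open>
  The matrix on \<open>F \<times> I\<close> that sends \<open>e\<^sub>f \<otimes> v\<close> to \<open>e\<^bsub>\<tau> f\<^esub> \<otimes> A\<^sub>f v\<close>. For \<open>\<tau> = id\<close> it is the direct sum of the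
  \<open>A\<^sub>f\<close>.
\<close>
definition ix_block :: "('f \<Rightarrow> 'f) \<Rightarrow> ('f \<Rightarrow> 'i \<Rightarrow> 'i \<Rightarrow> complex) \<Rightarrow> 'f \<times> 'i \<Rightarrow> 'f \<times> 'i \<Rightarrow> complex"
  where "ix_block \<tau> A = (\<lambda>(f', i) (f, j). if f' = \<tau> f then A f i j else 0)"

lemma isometric_ix_block:
  assumes "finite F" "bij_betw \<tau> F F" "\<And>f. f \<in> F \<Longrightarrow> isometric I (A f)"
  shows "isometric (F \<times> I) (ix_block \<tau> A)"
  unfolding isometric_def
proof (intro ballI)
  fix p q assume pq: "p \<in> F \<times> I" "q \<in> F \<times> I"
  obtain f i g j where e: "p = (f, i)" "q = (g, j)" by (cases p, cases q)
  have F: "f \<in> F" "g \<in> F" "\<tau> f \<in> F" "i \<in> I" "j \<in> I"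
    using pq assms(2) by (auto simp: e bij_betw_def)
  have "(\<Sum>r\<in>F \<times> I. cnj (ix_block \<tau> A r p) * ix_block \<tau> A r q)
      = (\<Sum>f'\<in>F. \<Sum>k\<in>I. cnj (ix_block \<tau> A (f', k) p) * ix_block \<tau> A (f', k) q)"
    by (simp only: sum.cartesian_product')
  also have "\<dots> = (\<Sum>f'\<in>F. if f' = \<tau> f then
      (\<Sum>k\<in>I. cnj (A f k i) * (if \<tau> f = \<tau> g then A g k j else 0)) else 0)"
    by (intro sum.cong refl) (auto simp: ix_block_def e)
  also have "\<dots> = (\<Sum>k\<in>I. cnj (A f k i) * (if \<tau> f = \<tau> g then A g k j else 0))"
    using F assms(1) by simp
  also have "\<dots> = of_bool (p = q)"
  proof (cases "f = g")
    case True
    then show ?thesis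
      using F isometricD[OF assms(3)[of f], of i j] by (simp add: e)
  next
    case False
    then have "\<tau> f \<noteq> \<tau> g"
      using F assms(2) by (auto simp: bij_betw_def inj_on_def)
    then show ?thesis using False by (simp add: e)
  qed
  finally show "(\<Sum>r\<in>F \<times> I. cnj (ix_block \<tau> A r p) * ix_block \<tau> A r q) = of_bool (p = q)" .
qed

lemma ix_mult_ix_block:
  assumes "finite F" "\<sigma> f \<in> F"
  shows "ix_mult (F \<times> I) (ix_block \<tau> A) (ix_block \<sigma> B) p (f, j)
    = ix_block (\<tau> \<circ> \<sigma>) (\<lambda>f. ix_mult I (A (\<sigma> f)) (B f)) p (f, j)"
proof -
  obtain f' i where p: "p = (f', i)" by (cases p)
  have "ix_mult (F \<times> I) (ix_block \<tau> A) (ix_block \<sigma> B) p (f, j)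
     = (\<Sum>g\<in>F. \<Sum>k\<in>I. ix_block \<tau> A p (g, k) * ix_block \<sigma> B (g, k) (f, j))"
    by (simp add: ix_mult_def sum.cartesian_product case_prod_unfold)
  also have "\<dots> = (\<Sum>g\<in>F. if g = \<sigma> f then
      (\<Sum>k\<in>I. (if f' = \<tau> (\<sigma> f) then A (\<sigma> f) i k else 0) * B f k j) else 0)"
    by (intro sum.cong refl) (auto simp: ix_block_def p)
  also have "\<dots> = (\<Sum>k\<in>I. (if f' = \<tau> (\<sigma> f) then A (\<sigma> f) i k else 0) * B f k j)"
    using assms by simp
  finally show ?thesis
    by (simp add: ix_block_def p ix_mult_def)
qed

text \<open>
  Only those \<open>f\<close> contribute whose blocks lie in the same position, because different positions of a block column
  do not overlap.
\<close>
lemma ix_inner_ix_block: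
  assumes "finite F" "\<And>f. f \<in> F \<Longrightarrow> \<tau> f \<in> F"
  shows "ix_inner (F \<times> I) (ix_block \<tau> A) (ix_block \<sigma> B)
    = (\<Sum>f\<in>F. if \<tau> f = \<sigma> f then ix_inner I (A f) (B f) else 0) / of_nat (card F)"
proof -
  have "(\<Sum>p\<in>F \<times> I. \<Sum>q\<in>F \<times> I. cnj (ix_block \<tau> A p q) * ix_block \<sigma> B p q)
    = (\<Sum>q\<in>F \<times> I. \<Sum>p\<in>F \<times> I. cnj (ix_block \<tau> A p q) * ix_block \<sigma> B p q)"
    by (rule sum.swap)
  also have "\<dots> = (\<Sum>f\<in>F. \<Sum>j\<in>I. \<Sum>f'\<in>F. \<Sum>i\<in>I. cnj (ix_block \<tau> A (f', i) (f, j)) * ix_block \<sigma> B (f', i) (f, j))"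
    by (simp only: sum.cartesian_product')
  also have "\<dots> = (\<Sum>f\<in>F. \<Sum>j\<in>I. \<Sum>f'\<in>F. if f' = \<tau> f then
      (\<Sum>i\<in>I. cnj (A f i j) * (if \<tau> f = \<sigma> f then B f i j else 0)) else 0)"
    by (intro sum.cong refl) (auto simp: ix_block_def)
  also have "\<dots> = (\<Sum>f\<in>F. \<Sum>j\<in>I. \<Sum>i\<in>I. cnj (A f i j) * (if \<tau> f = \<sigma> f then B f i j else 0))"
    using assms by simp
  also have "\<dots> = (\<Sum>f\<in>F. if \<tau> f = \<sigma> f then (\<Sum>i\<in>I. \<Sum>j\<in>I. cnj (A f i j) * B f i j) else 0)"
    by (intro sum.cong refl) (auto intro: sum.swap)
  finally show ?thesis
    unfolding ix_inner_def card_cartesian_product sum_divide_distrib[of _ F]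
    by (simp only: sum_divide_distrib[of _ F])
      (auto intro!: sum.cong simp: mult.commute)
qed

section \<open>Hyperlinearity in terms of inner products\<close>

lemma index_mat_adjoint:
  assumes "A \<in> carrier_mat n m" "i < m" "j < n"
  shows "mat_adjoint A $$ (i, j) = cnj (A $$ (j, i))"
  using assms by (auto simp: mat_adjoint_def mat_of_rows_def)

lemma index_mult_mat_ix_mult:
  assumes "A \<in> carrier_mat n n" "B \<in> carrier_mat n n" "i < n" "j < n"
  shows "(A * B) $$ (i, j) = ix_mult {..<n} (\<lambda>i j. A $$ (i, j)) (\<lambda>i j. B $$ (i, j)) i j"
  using assms by (auto simp: ix_mult_def scalar_prod_def atLeast0LessThan)

lemma unitary_mats_iff_isometric:
  "A \<in> unitary_mats n \<longleftrightarrow> A \<in> carrier_mat n n \<and> isometric {..<n} (\<lambda>i j. A $$ (i, j))"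
proof (cases "A \<in> carrier_mat n n")
  case True
  have adj: "mat_adjoint A \<in> carrier_mat n n"
    using True by (auto simp: mat_adjoint_def)
  have "mat_adjoint A * A = 1\<^sub>m n \<longleftrightarrow> isometric {..<n} (\<lambda>i j. A $$ (i, j))"
    using True adj
    by (auto simp: mat_eq_iff index_mult_mat_ix_mult[of _ n] isometric_def ix_mult_def index_mat_adjoint of_bool_def
        simp del: index_mult_mat(1))
  moreover have "A * mat_adjoint A = 1\<^sub>m n" if "mat_adjoint A * A = 1\<^sub>m n"
    using mat_mult_left_right_inverse[OF adj True that] .
  ultimately show ?thesis
    using True by (auto simp: unitary_mats_def)
qed (auto simp: unitary_mats_def)

lemma hs_dist_eq_ix_inner:
  assumes "n \<ge> 1" "isometric {..<n} u" "isometric {..<n} v"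
    and "\<And>i j. i < n \<Longrightarrow> j < n \<Longrightarrow> A $$ (i, j) = u i j"
    and "\<And>i j. i < n \<Longrightarrow> j < n \<Longrightarrow> B $$ (i, j) = v i j"
  shows "hs_dist n A B = sqrt (2 - 2 * Re (ix_inner {..<n} u v))"
proof -
  have "(\<Sum>i<n. \<Sum>j<n. (cmod (A $$ (i, j) - B $$ (i, j)))\<^sup>2) = (\<Sum>i<n. \<Sum>j<n. (cmod (u i j - v i j))\<^sup>2)"
    using assms by (intro sum.cong) auto
  moreover have "{..<n} \<noteq> {}"
    using assms(1) by (simp add: lessThan_empty_iff)
  ultimately show ?thesis
    using hs_square_eq[of "{..<n}" u v] assms(2,3) by (simp add: hs_dist_def)
qed

text \<open>
  An approximate representation on \<open>K\<close> with both requirements read off inner products. The type of the index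
  set is left open because direct sums and tensor powers change it.
\<close>
definition approx_rep ::
  "('g, 'm) monoid_scheme \<Rightarrow> 'g set \<Rightarrow> real \<Rightarrow> 'i set \<Rightarrow> ('g \<Rightarrow> 'i \<Rightarrow> 'i \<Rightarrow> complex) \<Rightarrow> bool"
  where "approx_rep G K \<delta> I \<theta> \<longleftrightarrow> finite I \<and> I \<noteq> {} \<and>
    (\<forall>g\<in>carrier G. isometric I (\<theta> g)) \<and>
    (\<forall>k\<in>K. \<forall>l\<in>K. Re (ix_inner I (ix_mult I (\<theta> k) (\<theta> l)) (\<theta> (k \<otimes>\<^bsub>G\<^esub> l))) \<ge> 1 - \<delta>) \<and>
    (\<forall>k\<in>K. \<forall>l\<in>K. k \<noteq> l \<longrightarrow> Re (ix_inner I (\<theta> k) (\<theta> l)) \<le> \<delta>)"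

text \<open>
  From \<open>d \<le> \<epsilon>\<close> one gets \<open>Re \<ge> 1 - \<epsilon>\<^sup>2 / 2\<close>, and from \<open>d \<ge> \<surd>2 - \<epsilon>\<close> one gets \<open>Re \<le> \<surd>2 \<epsilon>\<close>; both are
  within \<open>\<delta>\<close> once \<open>\<epsilon> \<le> 1\<close> and \<open>2 \<epsilon> \<le> \<delta>\<close>.
\<close>
lemma hyperlinear_imp_approx_rep:
  assumes "hyperlinear_group G" "finite K" "K \<subseteq> carrier G" "\<delta> > 0"
  shows "\<exists>n \<theta>. approx_rep G K \<delta> {..<n::nat} \<theta>"
proof -
  interpret group G using assms(1) by (simp add: hyperlinear_group_def)
  define \<epsilon> where "\<epsilon> = min 1 (\<delta> / 2)"
  have \<epsilon>: "0 < \<epsilon>" "\<epsilon> \<le> 1" "2 * \<epsilon> \<le> \<delta>"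
    using assms(4) by (auto simp: \<epsilon>_def)
  obtain n \<theta> where n: "1 \<le> n" and \<theta>: "\<theta> \<in> carrier G \<rightarrow> unitary_mats n"
    and h1: "\<And>k l. k \<in> K \<Longrightarrow> l \<in> K \<Longrightarrow> hs_dist n (\<theta> k * \<theta> l) (\<theta> (k \<otimes>\<^bsub>G\<^esub> l)) \<le> \<epsilon>"
    and h2: "\<And>k l. k \<in> K \<Longrightarrow> l \<in> K \<Longrightarrow> k \<noteq> l \<Longrightarrow> hs_dist n (\<theta> k) (\<theta> l) \<ge> sqrt 2 - \<epsilon>"
    using assms(1-3) \<epsilon>(1) unfolding hyperlinear_group_def by metis
  define u where "u = (\<lambda>g i j. \<theta> g $$ (i, j))"
  have \<theta>': "\<theta> g \<in> carrier_mat n n" "isometric {..<n} (u g)" if "g \<in> carrier G" for g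
    using \<theta> that by (auto simp: Pi_iff unitary_mats_iff_isometric u_def)
  have "approx_rep G K \<delta> {..<n} u"
    unfolding approx_rep_def
  proof (intro conjI ballI impI)
    fix k l assume kl: "k \<in> K" "l \<in> K"
    then have c: "k \<in> carrier G" "l \<in> carrier G" using assms(3) by auto
    have "hs_dist n (\<theta> k * \<theta> l) (\<theta> (k \<otimes>\<^bsub>G\<^esub> l))
        = sqrt (2 - 2 * Re (ix_inner {..<n} (ix_mult {..<n} (u k) (u l)) (u (k \<otimes>\<^bsub>G\<^esub> l))))"
      using c n by (intro hs_dist_eq_ix_inner isometric_ix_mult \<theta>')
        (auto simp: index_mult_mat_ix_mult[OF \<theta>'(1) \<theta>'(1)] u_def simp del: index_mult_mat(1))
    then have "sqrt (2 - 2 * Re (ix_inner {..<n} (ix_mult {..<n} (u k) (u l)) (u (k \<otimes>\<^bsub>G\<^esub> l)))) \<le> sqrt (\<epsilon>\<^sup>2)"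
      using h1[OF kl] \<epsilon> by simp
    then have "2 - 2 * Re (ix_inner {..<n} (ix_mult {..<n} (u k) (u l)) (u (k \<otimes>\<^bsub>G\<^esub> l))) \<le> \<epsilon>\<^sup>2"
      by (simp only: real_sqrt_le_iff)
    moreover have "\<epsilon>\<^sup>2 \<le> \<epsilon>"
      using \<epsilon> by (simp add: power2_eq_square mult_le_cancel_left1)
    ultimately show "Re (ix_inner {..<n} (ix_mult {..<n} (u k) (u l)) (u (k \<otimes>\<^bsub>G\<^esub> l))) \<ge> 1 - \<delta>"
      using \<epsilon> by linarith
  next
    fix k l assume kl: "k \<in> K" "l \<in> K" "k \<noteq> l"
    then have c: "k \<in> carrier G" "l \<in> carrier G" using assms(3) by auto
    have "hs_dist n (\<theta> k) (\<theta> l) = sqrt (2 - 2 * Re (ix_inner {..<n} (u k) (u l)))"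
      using c n by (intro hs_dist_eq_ix_inner \<theta>') (auto simp: u_def)
    then have le: "sqrt 2 - \<epsilon> \<le> sqrt (2 - 2 * Re (ix_inner {..<n} (u k) (u l)))"
      using h2[OF kl] by simp
    have s2: "1 \<le> sqrt 2" "sqrt 2 \<le> 2"
      using real_sqrt_le_mono[of 1 2] real_sqrt_le_mono[of 2 4] by simp_all
    have "(sqrt 2 - \<epsilon>)\<^sup>2 \<le> (sqrt (2 - 2 * Re (ix_inner {..<n} (u k) (u l))))\<^sup>2"
      using le s2 \<epsilon> by (intro power_mono) linarith+
    also have "\<dots> = 2 - 2 * Re (ix_inner {..<n} (u k) (u l))"
      using norm_ix_inner_le_1[of "{..<n}" "u k" "u l"] \<theta>'(2) c n complex_Re_le_cmod[of "ix_inner {..<n} (u k) (u l)"]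
      by (simp add: lessThan_empty_iff)
    finally have "2 * Re (ix_inner {..<n} (u k) (u l)) \<le> 2 * (sqrt 2 * \<epsilon>) - \<epsilon>\<^sup>2"
      by (simp add: power2_diff)
    moreover have "sqrt 2 * \<epsilon> \<le> 2 * \<epsilon>"
      using s2 \<epsilon> by (intro mult_right_mono) auto
    ultimately show "Re (ix_inner {..<n} (u k) (u l)) \<le> \<delta>"
      using \<epsilon> zero_le_power2[of \<epsilon>] by linarith
  qed (use \<theta>' n in \<open>auto simp: lessThan_empty_iff\<close>)
  then show ?thesis by blast
qed

text \<open>
  Transport along a numbering of the index set turns a model into honest matrices. The tolerance \<open>\<epsilon>\<^sup>2 / 2\<close> gives
  \<open>d\<^sup>2 \<le> \<epsilon>\<^sup>2\<close> for products and \<open>d\<^sup>2 \<ge> 2 - \<epsilon>\<^sup>2 \<ge> (\<surd>2 - \<epsilon>)\<^sup>2\<close> for distinct elements, the last step when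
  \<open>\<epsilon> \<le> \<surd>2\<close>.
\<close>
lemma hyperlinear_if_approx_reps:
  fixes G :: "('g, 'm) monoid_scheme"
  assumes "group G"
    and models: "\<And>K \<delta>. finite K \<Longrightarrow> K \<subseteq> carrier G \<Longrightarrow> \<delta> > 0 \<Longrightarrow> \<exists>(I :: 'i set) \<theta>. approx_rep G K \<delta> I \<theta>"
  shows "hyperlinear_group G"
  unfolding hyperlinear_group_def
proof (intro conjI allI impI assms(1))
  interpret group G by fact
  fix K :: "'g set" and \<epsilon> :: real
  assume *: "finite K \<and> K \<subseteq> carrier G \<and> 0 < \<epsilon>"
  then obtain I :: "'i set" and \<theta> where "approx_rep G K (\<epsilon>\<^sup>2 / 2) I \<theta>"
    using models[of K "\<epsilon>\<^sup>2 / 2"] by auto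
  then have I: "finite I" "I \<noteq> {}"
    and iso: "\<And>g. g \<in> carrier G \<Longrightarrow> isometric I (\<theta> g)"
    and mult: "\<And>k l. k \<in> K \<Longrightarrow> l \<in> K \<Longrightarrow> Re (ix_inner I (ix_mult I (\<theta> k) (\<theta> l)) (\<theta> (k \<otimes>\<^bsub>G\<^esub> l))) \<ge> 1 - \<epsilon>\<^sup>2 / 2"
    and sep: "\<And>k l. k \<in> K \<Longrightarrow> l \<in> K \<Longrightarrow> k \<noteq> l \<Longrightarrow> Re (ix_inner I (\<theta> k) (\<theta> l)) \<le> \<epsilon>\<^sup>2 / 2"
    by (auto simp: approx_rep_def)
  define n where "n = card I"
  have n: "n \<ge> 1" using I by (simp add: n_def Suc_le_eq card_gt_0_iff)
  obtain e where e: "bij_betw e {..<n} I"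
    using ex_bij_betw_nat_finite[OF I(1)] by (auto simp: n_def atLeast0LessThan)
  define pull :: "('i \<Rightarrow> 'i \<Rightarrow> complex) \<Rightarrow> nat \<Rightarrow> nat \<Rightarrow> complex" where "pull = (\<lambda>u i j. u (e i) (e j))"
  define M where "M = (\<lambda>g. mat n n (\<lambda>(i, j). \<theta> g (e i) (e j)))"
  have reindex: "(\<Sum>i<n. f (e i)) = sum f I" for f :: "'i \<Rightarrow> complex"
    by (rule sum.reindex_bij_betw[OF e])
  have eq_iff: "e i = e j \<longleftrightarrow> i = j" if "i < n" "j < n" for i j
    using e that by (auto simp: bij_betw_def inj_on_def)
  have mem: "e i \<in> I" if "i < n" for i
    using e that by (auto simp: bij_betw_def)
  have pull_comp: "ix_mult {..<n} (pull u) (pull v) = pull (ix_mult I u v)" for u v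
    by (simp add: ix_mult_def pull_def reindex[of "\<lambda>k. u _ k * v k _"])
  have pull_inner: "ix_inner {..<n} (pull u) (pull v) = ix_inner I u v" for u v
    by (simp add: ix_inner_def pull_def reindex[of "\<lambda>j. cnj (u _ j) * v _ j"]
        reindex[of "\<lambda>i. \<Sum>j\<in>I. cnj (u i j) * v i j"] n_def[symmetric])
  have pull_iso: "isometric {..<n} (pull u)" if "isometric I u" for u
    using isometricD[OF that mem mem]
    by (simp add: isometric_def pull_def reindex[of "\<lambda>k. cnj (u k _) * u k _"] eq_iff)
  have M: "M g \<in> carrier_mat n n" for g
    by (simp add: M_def)
  have M_index: "M g $$ (i, j) = pull (\<theta> g) i j" if "i < n" "j < n" for g i j
    using that by (simp add: M_def pull_def)
  have M_mult: "(M k * M l) $$ (i, j) = pull (ix_mult I (\<theta> k) (\<theta> l)) i j" if "i < n" "j < n" for k l i j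
    using that index_mult_mat_ix_mult[OF M M that, of k l] pull_comp[of "\<theta> k" "\<theta> l", symmetric]
    by (simp add: ix_mult_def M_index)
  have unitary: "M g \<in> unitary_mats n" if "g \<in> carrier G" for g
  proof -
    have "isometric {..<n} (\<lambda>i j. M g $$ (i, j)) \<longleftrightarrow> isometric {..<n} (pull (\<theta> g))"
      by (simp add: isometric_def M_index)
    then show ?thesis
      using M pull_iso iso[OF that] by (simp add: unitary_mats_iff_isometric)
  qed
  have dist_mult: "hs_dist n (M k * M l) (M (k \<otimes>\<^bsub>G\<^esub> l)) \<le> \<epsilon>" if kl: "k \<in> K" "l \<in> K" for k l
  proof -
    have c: "k \<in> carrier G" "l \<in> carrier G" using kl * by auto
    have "hs_dist n (M k * M l) (M (k \<otimes>\<^bsub>G\<^esub> l))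
        = sqrt (2 - 2 * Re (ix_inner I (ix_mult I (\<theta> k) (\<theta> l)) (\<theta> (k \<otimes>\<^bsub>G\<^esub> l))))"
      unfolding pull_inner[symmetric]
      using c n I by (intro hs_dist_eq_ix_inner pull_iso isometric_ix_mult iso M_index M_mult) auto
    also have "\<dots> \<le> sqrt (\<epsilon>\<^sup>2)"
      using mult[OF kl] by (intro real_sqrt_le_mono) linarith
    finally show ?thesis using * by simp
  qed
  have dist_sep: "hs_dist n (M k) (M l) \<ge> sqrt 2 - \<epsilon>" if kl: "k \<in> K" "l \<in> K" "k \<noteq> l" for k l
  proof -
    have c: "k \<in> carrier G" "l \<in> carrier G" using kl * by auto
    have eq: "hs_dist n (M k) (M l) = sqrt (2 - 2 * Re (ix_inner I (\<theta> k) (\<theta> l)))"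
      unfolding pull_inner[symmetric]
      using c n by (intro hs_dist_eq_ix_inner pull_iso iso M_index) auto
    show ?thesis
    proof (cases "\<epsilon> \<le> sqrt 2")
      case True
      then have "\<epsilon> * \<epsilon> \<le> sqrt 2 * \<epsilon>"
        using * by (intro mult_right_mono) auto
      then have "(sqrt 2 - \<epsilon>)\<^sup>2 \<le> 2 - 2 * Re (ix_inner I (\<theta> k) (\<theta> l))"
        using sep[OF kl] unfolding power2_diff by (simp add: power2_eq_square)
      then show ?thesis
        unfolding eq by (rule real_le_rsqrt)
    next
      case False
      have "0 \<le> hs_dist n (M k) (M l)"
        by (simp add: hs_dist_def sum_nonneg)
      then show ?thesis using False by linarith
    qed
  qed
  show "\<exists>n \<theta>. 1 \<le> n \<and> \<theta> \<in> carrier G \<rightarrow> unitary_mats n \<and>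
      (\<forall>k\<in>K. \<forall>l\<in>K. hs_dist n (\<theta> k * \<theta> l) (\<theta> (k \<otimes>\<^bsub>G\<^esub> l)) \<le> \<epsilon>) \<and>
      (\<forall>k\<in>K. \<forall>l\<in>K. k \<noteq> l \<longrightarrow> sqrt 2 - \<epsilon> \<le> hs_dist n (\<theta> k) (\<theta> l))"
    using n unitary dist_mult dist_sep by (intro exI[of _ n] exI[of _ M]) auto
qed

section \<open>Amplification and direct powers\<close>

text \<open>
  A point of the unit disc with real part near 1 is itself near 1, and \<open>z \<mapsto> z\<^sup>m\<close> is \<open>m\<close>-Lipschitz on the disc.
\<close>
lemma Re_power_ge:
  assumes "cmod z \<le> 1" "Re z \<ge> 1 - \<delta>"
  shows "Re (z ^ m) \<ge> 1 - real m * sqrt (2 * \<delta>)"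
proof -
  have "(cmod (z - 1))\<^sup>2 = (cmod z)\<^sup>2 + 1 - 2 * Re z"
    unfolding cmod_power2 by (simp add: power2_eq_square algebra_simps)
  moreover have "(cmod z)\<^sup>2 \<le> 1"
    using assms(1) by (simp add: power_le_one)
  ultimately have "(cmod (z - 1))\<^sup>2 \<le> 2 * \<delta>"
    using assms(2) by linarith
  then have "cmod (z - 1) \<le> sqrt (2 * \<delta>)"
    by (rule real_le_rsqrt)
  have "1 - Re (z ^ m) \<le> cmod (1 ^ m - z ^ m)"
    using complex_Re_le_cmod[of "1 - z ^ m"] by simp
  also have "\<dots> \<le> real m * cmod (1 - z)"
    using assms(1) by (intro norm_power_diff) auto
  also have "\<dots> \<le> real m * sqrt (2 * \<delta>)"
    using \<open>cmod (z - 1) \<le> sqrt (2 * \<delta>)\<close> by (intro mult_left_mono) (auto simp: norm_minus_commute)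
  finally show ?thesis by linarith
qed

text \<open>
  Amplification: modulus (not merely real part) bounded away from 1 is a weak separation that
  tensor powers improve to any degree, while the multiplicativity error grows from \<open>\<gamma>\<close> to at most
  \<open>m \<surd>(2 \<gamma>)\<close>. So \<open>m\<close> can be chosen first, from \<open>c\<close>, and \<open>\<gamma>\<close> afterwards.
\<close>
lemma approx_rep_ix_power:
  assumes "finite I" "I \<noteq> {}" "group G" "K \<subseteq> carrier G"
    and iso: "\<And>g. g \<in> carrier G \<Longrightarrow> isometric I (\<theta> g)"
    and mult: "\<And>k l. k \<in> K \<Longrightarrow> l \<in> K \<Longrightarrow> Re (ix_inner I (ix_mult I (\<theta> k) (\<theta> l)) (\<theta> (k \<otimes>\<^bsub>G\<^esub> l))) \<ge> 1 - \<gamma>"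
    and sep: "\<And>k l. k \<in> K \<Longrightarrow> l \<in> K \<Longrightarrow> k \<noteq> l \<Longrightarrow> cmod (ix_inner I (\<theta> k) (\<theta> l)) \<le> c"
    and m: "real m * sqrt (2 * \<gamma>) \<le> \<delta>" "c ^ m \<le> \<delta>"
  shows "approx_rep G K \<delta> ({..<m} \<rightarrow>\<^sub>E I) (\<lambda>g. ix_power m (\<theta> g))"
  unfolding approx_rep_def
proof (intro conjI ballI impI)
  interpret group G by fact
  fix k l assume kl: "k \<in> K" "l \<in> K"
  then have "k \<in> carrier G" "l \<in> carrier G" using assms(4) by auto
  then have "cmod (ix_inner I (ix_mult I (\<theta> k) (\<theta> l)) (\<theta> (k \<otimes>\<^bsub>G\<^esub> l))) \<le> 1"
    using assms(1,2) by (intro norm_ix_inner_le_1 isometric_ix_mult iso) auto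
  from Re_power_ge[OF this mult[OF kl], of m]
  show "Re (ix_inner ({..<m} \<rightarrow>\<^sub>E I) (ix_mult ({..<m} \<rightarrow>\<^sub>E I) (ix_power m (\<theta> k)) (ix_power m (\<theta> l)))
      (ix_power m (\<theta> (k \<otimes>\<^bsub>G\<^esub> l)))) \<ge> 1 - \<delta>"
    using m(1) by (simp add: ix_mult_ix_power ix_inner_ix_power assms(1))
next
  fix k l assume kl: "k \<in> K" "l \<in> K" "k \<noteq> l"
  have "Re (ix_inner I (\<theta> k) (\<theta> l) ^ m) \<le> cmod (ix_inner I (\<theta> k) (\<theta> l)) ^ m"
    using complex_Re_le_cmod[of "ix_inner I (\<theta> k) (\<theta> l) ^ m"] by (simp add: norm_power)
  also have "\<dots> \<le> c ^ m"
    using sep[OF kl] by (intro power_mono) auto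
  finally show "Re (ix_inner ({..<m} \<rightarrow>\<^sub>E I) (ix_power m (\<theta> k)) (ix_power m (\<theta> l))) \<le> \<delta>"
    using m(2) by (simp add: ix_inner_ix_power assms(1))
qed (use assms(1,2) iso in \<open>auto simp: PiE_eq_empty_iff intro!: isometric_ix_power finite_PiE\<close>)

lemma ix_inner_ix_one:
  assumes "finite I" "I \<noteq> {}"
  shows "ix_inner I ix_one ix_one = 1"
proof -
  have "(\<Sum>i\<in>I. \<Sum>j\<in>I. cnj (ix_one i j) * ix_one i j) = (\<Sum>i\<in>I. 1)"
    using assms(1) by (intro sum.cong refl) (simp add: ix_one_def of_bool_def if_distrib cong: if_cong)
  then show ?thesis using assms by (simp add: ix_inner_def)
qed

lemma finite_separating_coordinates:
  assumes "finite K" "K \<subseteq> (\<Pi>\<^sub>E x\<in>X. A x)"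
  obtains S where "finite S" "S \<subseteq> X"
    "\<And>k l. k \<in> K \<Longrightarrow> l \<in> K \<Longrightarrow> k \<noteq> l \<Longrightarrow> \<exists>s\<in>S. k s \<noteq> l s"
proof -
  have "\<exists>x\<in>X. k x \<noteq> l x" if "k \<in> K" "l \<in> K" "k \<noteq> l" for k l
    using that assms(2) by (metis PiE_ext subsetD)
  then obtain x where x: "\<And>k l. k \<in> K \<Longrightarrow> l \<in> K \<Longrightarrow> k \<noteq> l \<Longrightarrow> x k l \<in> X \<and> k (x k l) \<noteq> l (x k l)"
    by metis
  define P where "P = {p \<in> K \<times> K. fst p \<noteq> snd p}"
  show thesis
  proof (rule that[of "(\<lambda>p. x (fst p) (snd p)) ` P"])
    show "finite ((\<lambda>p. x (fst p) (snd p)) ` P)"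
      using assms(1) by (simp add: P_def)
    show "(\<lambda>p. x (fst p) (snd p)) ` P \<subseteq> X"
      using x by (auto simp: P_def)
    fix k l assume kl: "k \<in> K" "l \<in> K" "k \<noteq> l"
    then have "x k l \<in> (\<lambda>p. x (fst p) (snd p)) ` P"
      by (intro image_eqI[of _ _ "(k, l)"]) (auto simp: P_def)
    then show "\<exists>s\<in>(\<lambda>p. x (fst p) (snd p)) ` P. k s \<noteq> l s"
      using x[OF kl] by blast
  qed
qed

text \<open>
  The direct sum of a trivial summand and one copy of \<open>\<theta>\<close> for each separating coordinate has inner products
  of modulus at most \<open>c < 1\<close>; amplification finishes the proof. The parameters are chosen in the order
  \<open>S\<close>, \<open>c\<close>, \<open>m\<close>, \<open>\<gamma>\<close>, \<open>\<theta>\<close>.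
\<close>
theorem hyperlinear_direct_power:
  fixes G :: "('a, 'm) monoid_scheme" and X :: "'x set"
  assumes "hyperlinear_group G"
  shows "hyperlinear_group (product_group X (\<lambda>_. G))"
proof (rule hyperlinear_if_approx_reps)
  interpret group G using assms by (simp add: hyperlinear_group_def)
  show grp: "group (product_group X (\<lambda>_. G))"
    by (intro product_group) (rule group_axioms)
  fix K :: "('x \<Rightarrow> 'a) set" and \<delta> :: real
  assume fin: "finite K" and K: "K \<subseteq> carrier (product_group X (\<lambda>_. G))" and "\<delta> > 0"
  obtain S where S: "finite S" "S \<subseteq> X"
    and sepS: "\<And>k l. k \<in> K \<Longrightarrow> l \<in> K \<Longrightarrow> k \<noteq> l \<Longrightarrow> \<exists>s\<in>S. k s \<noteq> l s"
    using finite_separating_coordinates[OF fin, of X "\<lambda>_. carrier G"] K by auto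
  \<comment> \<open>The index \<open>None\<close> stands for the trivial summand.\<close>
  define F where "F = insert None (Some ` S)"
  define N where "N = real (card S) + 1"
  have F: "finite F" "F \<noteq> {}" "real (card F) = N"
    using S(1) by (auto simp: F_def N_def card_image card_insert_if)
  have N: "N \<ge> 1" by (simp add: N_def)
  \<comment> \<open>Of the \<open>N\<close> summands, the trivial one and one separating coordinate together contribute
    at most \<open>3 / 2\<close> instead of 2.\<close>
  define c where "c = 1 - 1 / (2 * N)"
  have c: "0 \<le> c" "c < 1" using N by (auto simp: c_def field_simps)
  obtain m where m: "c ^ m < \<delta>"
    using real_arch_pow_inv[OF \<open>\<delta> > 0\<close> c(2)] by blast
  define \<gamma> where "\<gamma> = min (1 / 8) ((\<delta> / (real m + 1))\<^sup>2 / 2)"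
  have \<gamma>: "0 < \<gamma>" "\<gamma> \<le> 1 / 8" "2 * \<gamma> \<le> (\<delta> / (real m + 1))\<^sup>2"
    using \<open>\<delta> > 0\<close> by (auto simp: \<gamma>_def)
  have m\<gamma>: "real m * sqrt (2 * \<gamma>) \<le> \<delta>"
  proof -
    have "sqrt (2 * \<gamma>) \<le> \<delta> / (real m + 1)"
      using \<gamma>(3) \<open>\<delta> > 0\<close> by (intro real_le_lsqrt) auto
    then have "real m * sqrt (2 * \<gamma>) \<le> real m * (\<delta> / (real m + 1))"
      by (intro mult_left_mono) auto
    also have "\<dots> \<le> \<delta>" using \<open>\<delta> > 0\<close> by (simp add: field_simps)
    finally show ?thesis .
  qed
  define K' where "K' = (\<lambda>(k, s). k s) ` (K \<times> S)"
  have K': "finite K'" "K' \<subseteq> carrier G"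
    using fin S K by (auto simp: K'_def PiE_iff)
  have K'_mem: "k s \<in> K'" if "k \<in> K" "s \<in> S" for k s
    using that by (auto simp: K'_def)
  obtain n \<theta> where mod: "approx_rep G K' \<gamma> {..<n::nat} \<theta>"
    using hyperlinear_imp_approx_rep[OF assms K' \<gamma>(1)] by blast
  define I where "I = {..<n}"
  have I: "finite I" "I \<noteq> {}" and iso: "\<And>g. g \<in> carrier G \<Longrightarrow> isometric I (\<theta> g)"
    and mult: "\<And>k l. k \<in> K' \<Longrightarrow> l \<in> K' \<Longrightarrow> Re (ix_inner I (ix_mult I (\<theta> k) (\<theta> l)) (\<theta> (k \<otimes>\<^bsub>G\<^esub> l))) \<ge> 1 - \<gamma>"
    and sep: "\<And>k l. k \<in> K' \<Longrightarrow> l \<in> K' \<Longrightarrow> k \<noteq> l \<Longrightarrow> Re (ix_inner I (\<theta> k) (\<theta> l)) \<le> \<gamma>"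
    using mod by (auto simp: approx_rep_def I_def)
  define A where "A = (\<lambda>g :: 'x \<Rightarrow> 'a. case_option ix_one (\<lambda>s. \<theta> (g s)))"
  define \<rho> where "\<rho> = (\<lambda>g :: 'x \<Rightarrow> 'a. ix_block id (A g))"
  have sumF: "sum f F = f None + (\<Sum>s\<in>S. f (Some s))" for f :: "'x option \<Rightarrow> complex"
    using S(1) by (simp add: F_def sum.reindex)
  have isoA: "isometric I (A g f)" if "g \<in> carrier (product_group X (\<lambda>_. G))" "f \<in> F" for g f
    using that S(2) I(1) by (auto simp: F_def A_def isometric_ix_one PiE_iff intro!: iso)
  have iso_\<rho>: "isometric (F \<times> I) (\<rho> g)" if "g \<in> carrier (product_group X (\<lambda>_. G))" for g
    unfolding \<rho>_def using F(1) isoA[OF that] by (intro isometric_ix_block) auto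
  have mult_\<rho>: "Re (ix_inner (F \<times> I) (ix_mult (F \<times> I) (\<rho> k) (\<rho> l)) (\<rho> (k \<otimes>\<^bsub>product_group X (\<lambda>_. G)\<^esub> l))) \<ge> 1 - \<gamma>"
    if kl: "k \<in> K" "l \<in> K" for k l
  proof -
    let ?kl = "k \<otimes>\<^bsub>product_group X (\<lambda>_. G)\<^esub> l"
    have "ix_inner (F \<times> I) (ix_mult (F \<times> I) (\<rho> k) (\<rho> l)) (\<rho> ?kl)
        = ix_inner (F \<times> I) (ix_block id (\<lambda>f. ix_mult I (A k f) (A l f))) (\<rho> ?kl)"
      unfolding \<rho>_def using F(1) by (intro ix_inner_cong) (auto simp: ix_mult_ix_block)
    also have "\<dots> = (\<Sum>f\<in>F. ix_inner I (ix_mult I (A k f) (A l f)) (A ?kl f)) / of_nat (card F)"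
      unfolding \<rho>_def using F(1) by (subst ix_inner_ix_block) auto
    also have "(\<Sum>f\<in>F. ix_inner I (ix_mult I (A k f) (A l f)) (A ?kl f))
        = 1 + (\<Sum>s\<in>S. ix_inner I (ix_mult I (\<theta> (k s)) (\<theta> (l s))) (\<theta> (k s \<otimes>\<^bsub>G\<^esub> l s)))"
    proof -
      have "ix_inner I (ix_mult I ix_one ix_one) ix_one = 1"
        using ix_inner_ix_one[OF I] ix_inner_cong[of I "ix_mult I ix_one ix_one" ix_one ix_one ix_one] ix_mult_ix_one[OF I(1)] by simp
      then show ?thesis
        unfolding sumF using S(2) by (auto simp: A_def intro!: sum.cong)
    qed
    finally have "Re (ix_inner (F \<times> I) (ix_mult (F \<times> I) (\<rho> k) (\<rho> l)) (\<rho> ?kl))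
       = (1 + (\<Sum>s\<in>S. Re (ix_inner I (ix_mult I (\<theta> (k s)) (\<theta> (l s))) (\<theta> (k s \<otimes>\<^bsub>G\<^esub> l s))))) / N"
      by (simp only: Re_divide_of_nat Re_sum plus_complex.sel one_complex.sel F(3))
    also have "\<dots> \<ge> (1 + (\<Sum>s\<in>S. 1 - \<gamma>)) / N"
      using N kl by (intro divide_right_mono add_left_mono sum_mono mult K'_mem) auto
    also have "(1 + (\<Sum>s\<in>S. 1 - \<gamma>)) / N \<ge> 1 - \<gamma>"
      using N \<gamma>(1) by (simp add: N_def field_simps)
    finally show ?thesis .
  qed
  have sep_\<rho>: "cmod (ix_inner (F \<times> I) (\<rho> k) (\<rho> l)) \<le> c" if kl: "k \<in> K" "l \<in> K" "k \<noteq> l" for k l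
  proof -
    obtain s where s: "s \<in> S" "k s \<noteq> l s" using sepS[OF kl] by blast
    define z where "z = (\<lambda>s. ix_inner I (\<theta> (k s)) (\<theta> (l s)))"
    have z1: "cmod (z t) \<le> 1" if "t \<in> S" for t
      unfolding z_def using that kl K'(2) K'_mem by (intro norm_ix_inner_le_1 I iso) auto
    have "Re (z s) \<le> 1 / 8"
      unfolding z_def using sep[of "k s" "l s"] s kl K'_mem \<gamma>(2) by fastforce
    moreover have "(cmod (z s))\<^sup>2 \<le> 1"
      using z1[OF s(1)] by (simp add: power_le_one)
    \<comment> \<open>Here \<open>\<bar>1 + z\<bar>\<^sup>2 = 1 + 2 Re z + \<bar>z\<bar>\<^sup>2 \<le> 2 + 1 / 4\<close>, which is why \<open>\<gamma> \<le> 1 / 8\<close> was imposed.\<close>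
    ultimately have "(cmod (1 + z s))\<^sup>2 \<le> (3 / 2)\<^sup>2"
      unfolding cmod_power2 by (simp add: power2_eq_square algebra_simps)
    then have zs: "cmod (1 + z s) \<le> 3 / 2"
      by (rule power2_le_imp_le) simp
    have "ix_inner (F \<times> I) (\<rho> k) (\<rho> l) = (\<Sum>f\<in>F. ix_inner I (A k f) (A l f)) / of_nat (card F)"
      unfolding \<rho>_def using F(1) by (subst ix_inner_ix_block) auto
    also have "(\<Sum>f\<in>F. ix_inner I (A k f) (A l f)) = (1 + z s) + (\<Sum>t\<in>S - {s}. z t)"
      unfolding sumF using S(1) s(1) by (simp add: A_def z_def ix_inner_ix_one[OF I] sum.remove[of S s])
    finally have "cmod (ix_inner (F \<times> I) (\<rho> k) (\<rho> l)) = cmod ((1 + z s) + (\<Sum>t\<in>S - {s}. z t)) / N"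
      using F(3) by (simp add: norm_divide)
    also have "\<dots> \<le> (3 / 2 + (\<Sum>t\<in>S - {s}. 1)) / N"
      using N z1 by (intro divide_right_mono order_trans[OF norm_triangle_ineq] add_mono zs sum_norm_le) auto
    also have "\<dots> = c"
    proof -
      have "(\<Sum>t\<in>S - {s}. 1) = N - 2"
        using card_Suc_Diff1[OF S(1) s(1)] unfolding N_def sum_constant mult_1_right by linarith
      then show ?thesis using N by (simp add: c_def field_simps)
    qed
    finally show ?thesis .
  qed
  have "approx_rep (product_group X (\<lambda>_. G)) K \<delta> ({..<m} \<rightarrow>\<^sub>E F \<times> I) (\<lambda>g. ix_power m (\<rho> g))"
    using F I grp K iso_\<rho> mult_\<rho> sep_\<rho> m\<gamma> m
    by (intro approx_rep_ix_power[of _ _ _ _ \<gamma> c]) auto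
  then show "\<exists>(I :: (nat \<Rightarrow> 'x option \<times> nat) set) \<theta>. approx_rep (product_group X (\<lambda>_. G)) K \<delta> I \<theta>"
    by blast
qed

section \<open>Induction over a Folner set\<close>

text \<open>
  The domain and the image of the part of \<open>p\<close> that stays in \<open>F\<close> have complements of equal size in \<open>F\<close>.
\<close>
lemma extend_to_permutation:
  assumes "finite F" "inj_on p F"
  obtains \<tau> where "bij_betw \<tau> F F" "\<And>f. f \<in> F \<Longrightarrow> p f \<in> F \<Longrightarrow> \<tau> f = p f"
proof -
  define D where "D = {f \<in> F. p f \<in> F}"
  have D: "finite D" "D \<subseteq> F" "p ` D \<subseteq> F" "inj_on p D"
    using assms by (auto simp: D_def inj_on_def)
  have "card (F - D) = card (F - p ` D)"
    using assms(1) D by (simp add: card_Diff_subset card_image)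
  then obtain q where "bij_betw q (F - D) (F - p ` D)"
    using finite_same_card_bij[of "F - D" "F - p ` D"] assms(1) by auto
  moreover have "bij_betw p D (p ` D)"
    using D(4) by (simp add: bij_betw_def)
  ultimately have "bij_betw (\<lambda>f. if f \<in> D then p f else q f) (D \<union> (F - D)) (p ` D \<union> (F - p ` D))"
    by (intro bij_betw_disjoint_Un) auto
  moreover have "D \<union> (F - D) = F" "p ` D \<union> (F - p ` D) = F"
    using D by auto
  ultimately show thesis
    by (intro that[of "\<lambda>f. if f \<in> D then p f else q f"]) (auto simp: D_def)
qed

lemma average_le:
  fixes c :: "'f \<Rightarrow> real"
  assumes "finite F" "F \<noteq> {}" "B \<subseteq> F" "real (card B) \<le> b * real (card F)" "d \<ge> 0"
    and "\<And>f. f \<in> F \<Longrightarrow> c f \<le> a + (if f \<in> B then d else 0)"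
  shows "(\<Sum>f\<in>F. c f) / real (card F) \<le> a + d * b"
proof -
  have "(\<Sum>f\<in>F. c f) \<le> (\<Sum>f\<in>F. a + (if f \<in> B then d else 0))"
    by (intro sum_mono assms(6))
  also have "\<dots> = a * real (card F) + d * real (card B)"
    using assms(1,3) by (simp add: sum.distrib sum.If_cases Int_absorb1)
  also have "\<dots> \<le> a * real (card F) + d * (b * real (card F))"
    using assms(4,5) by (intro add_left_mono mult_left_mono) auto
  finally show ?thesis
    using assms(1,2) by (simp add: divide_le_eq card_gt_0_iff algebra_simps)
qed

text \<open>
  The points of \<open>F\<close> that \<open>h\<close> moves out of \<open>F\<close> are those outside \<open>h\<inverse>F\<close>, so the Folner condition is
  applied to inverses.
\<close>
lemma Folner_set_left_translation:
  assumes "amenable_group H" "finite S" "S \<subseteq> carrier H" "(\<eta>::real) > 0"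
  obtains F where "finite F" "F \<noteq> {}" "F \<subseteq> carrier H"
    "\<And>h. h \<in> S \<Longrightarrow> real (card {f \<in> F. h \<otimes>\<^bsub>H\<^esub> f \<notin> F}) \<le> \<eta> * real (card F)"
proof -
  interpret group H using assms(1) by (simp add: amenable_group_def)
  have "finite ((\<lambda>h. inv\<^bsub>H\<^esub> h) ` S)" "(\<lambda>h. inv\<^bsub>H\<^esub> h) ` S \<subseteq> carrier H"
    using assms by auto
  then obtain F where F: "finite F" "F \<noteq> {}" "F \<subseteq> carrier H"
    and folner: "\<And>h. h \<in> S \<Longrightarrow> real (card (F - (inv\<^bsub>H\<^esub> h <#\<^bsub>H\<^esub> F))) < \<eta> * real (card F)"
    using assms(1,4) unfolding amenable_group_def by (metis imageI)
  show thesis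
  proof (rule that[OF F])
    fix h assume h: "h \<in> S"
    have "{f \<in> F. h \<otimes>\<^bsub>H\<^esub> f \<notin> F} \<subseteq> F - (inv\<^bsub>H\<^esub> h <#\<^bsub>H\<^esub> F)"
    proof (safe)
      fix f assume f: "f \<in> inv\<^bsub>H\<^esub> h <#\<^bsub>H\<^esub> F" "h \<otimes>\<^bsub>H\<^esub> f \<notin> F"
      then obtain f' where "f' \<in> F" "f = inv\<^bsub>H\<^esub> h \<otimes>\<^bsub>H\<^esub> f'"
        by (auto simp: l_coset_def)
      moreover have "h \<in> carrier H" "f' \<in> carrier H"
        using h assms(3) F(3) \<open>f' \<in> F\<close> by auto
      ultimately show False
        using f(2) by (simp add: m_assoc[symmetric])
    qed
    then have "card {f \<in> F. h \<otimes>\<^bsub>H\<^esub> f \<notin> F} \<le> card (F - (inv\<^bsub>H\<^esub> h <#\<^bsub>H\<^esub> F))"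
      using F(1) by (intro card_mono) auto
    then show "real (card {f \<in> F. h \<otimes>\<^bsub>H\<^esub> f \<notin> F}) \<le> \<eta> * real (card F)"
      using folner[OF h] by linarith
  qed
qed

theorem theorem2:
  fixes G :: "('a, 'm) monoid_scheme" and H :: "('b, 'n) monoid_scheme"
  assumes "hyperlinear_group G" and "amenable_group H"
  shows "hyperlinear_group (unrestricted_wreath G H)"
proof (rule hyperlinear_if_approx_reps)
  interpret G: group G using assms(1) by (simp add: hyperlinear_group_def)
  interpret H: group H using assms(2) by (simp add: amenable_group_def)
  let ?W = "unrestricted_wreath G H" and ?N = "product_group (carrier H) (\<lambda>_. G)"
  interpret N: group ?N by (intro product_group) (rule G.group_axioms)
  show "group ?W"
    by (intro group_unrestricted_wreath G.group_axioms H.group_axioms)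
  fix K :: "(('b \<Rightarrow> 'a) \<times> 'b) set" and \<delta> :: real
  assume fin: "finite K" and K: "K \<subseteq> carrier ?W" and "\<delta> > 0"
  have Kc: "g \<in> carrier ?N" "h \<in> carrier H" if "(g, h) \<in> K" for g h
    using K that by (auto simp: unrestricted_wreath_def)
  \<comment> \<open>Besides the \<open>H\<close>-components of \<open>K\<close>, those of products must be almost invariant too: the image of a
    product is compared with the product of the images.\<close>
  define S where "S = snd ` K \<union> (\<lambda>(p, q). snd p \<otimes>\<^bsub>H\<^esub> snd q) ` (K \<times> K)"
  have S: "finite S" "S \<subseteq> carrier H"
    using fin Kc(2) by (auto simp: S_def)
  have SI: "h \<in> S" if "(g, h) \<in> K" for g h
    using that by (force simp: S_def)
  have SI2: "h \<otimes>\<^bsub>H\<^esub> h' \<in> S" if "(g, h) \<in> K" "(g', h') \<in> K" for g h g' h'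
    using that by (force simp: S_def)
  \<comment> \<open>Two translations occur in each estimate, so at most \<open>\<delta> / 4\<close> of \<open>F\<close> is lost; as a lost point costs at
    most 2, this spends \<open>\<delta> / 2\<close> and leaves \<open>\<delta> / 2\<close> for the tolerance of \<open>\<sigma>\<close>.\<close>
  have "\<delta> / 8 > 0" using \<open>\<delta> > 0\<close> by simp
  then obtain F where F: "finite F" "F \<noteq> {}" "F \<subseteq> carrier H"
    and folner: "\<And>h. h \<in> S \<Longrightarrow> real (card {f \<in> F. h \<otimes>\<^bsub>H\<^esub> f \<notin> F}) \<le> \<delta> / 8 * real (card F)"
    using Folner_set_left_translation[OF assms(2) S] by blast
  have "\<exists>\<tau>. bij_betw \<tau> F F \<and> (\<forall>f\<in>F. h \<otimes>\<^bsub>H\<^esub> f \<in> F \<longrightarrow> \<tau> f = h \<otimes>\<^bsub>H\<^esub> f)" if "h \<in> carrier H" for h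
  proof -
    have "inj_on (\<lambda>f. h \<otimes>\<^bsub>H\<^esub> f) F"
      using that F(3) by (intro inj_onI) (metis H.Units_l_cancel H.Units_eq subsetD)
    from extend_to_permutation[OF F(1) this] show ?thesis by metis
  qed
  then obtain \<tau> where \<tau>: "\<And>h. h \<in> carrier H \<Longrightarrow> bij_betw (\<tau> h) F F"
    and \<tau>_eq: "\<And>h f. h \<in> carrier H \<Longrightarrow> f \<in> F \<Longrightarrow> h \<otimes>\<^bsub>H\<^esub> f \<in> F \<Longrightarrow> \<tau> h f = h \<otimes>\<^bsub>H\<^esub> f"
    by metis
  have \<tau>_mem: "\<tau> h f \<in> F" if "h \<in> carrier H" "f \<in> F" for h f
    using \<tau>[OF that(1)] that(2) by (auto simp: bij_betw_def)
  have Fc: "f \<in> carrier H" if "f \<in> F" for f using that F(3) by auto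
  define shift where "shift = (\<lambda>(g :: 'b \<Rightarrow> 'a) f. \<lambda>x\<in>carrier H. g (f \<otimes>\<^bsub>H\<^esub> x))"
  have shift: "shift g f \<in> carrier ?N" if "g \<in> carrier ?N" "f \<in> carrier H" for g f
    using that by (auto simp: shift_def PiE_iff)
  \<comment> \<open>Only translates by points of \<open>F\<close> enter the blocks, so finitely many functions have to be
    represented well, however large the functions themselves are.\<close>
  define K' where "K' = (\<lambda>(p, f). shift (fst p) f) ` (K \<times> F)"
  have K': "finite K'" "K' \<subseteq> carrier ?N"
    using fin F shift Kc(1) Fc by (auto simp: K'_def simp del: carrier_product_group)
  have K'_mem: "shift g f \<in> K'" if "(g, h) \<in> K" "f \<in> F" for g h f
    using that by (force simp: K'_def)
  obtain n \<sigma> where mod: "approx_rep ?N K' (\<delta> / 2) {..<n::nat} \<sigma>"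
    using hyperlinear_imp_approx_rep[OF hyperlinear_direct_power[OF assms(1)] K', of "\<delta> / 2"] \<open>\<delta> > 0\<close>
    by auto
  define I where "I = {..<n}"
  have I: "finite I" "I \<noteq> {}" and iso: "\<And>g. g \<in> carrier ?N \<Longrightarrow> isometric I (\<sigma> g)"
    and mult: "\<And>k l. k \<in> K' \<Longrightarrow> l \<in> K' \<Longrightarrow> Re (ix_inner I (ix_mult I (\<sigma> k) (\<sigma> l)) (\<sigma> (k \<otimes>\<^bsub>?N\<^esub> l))) \<ge> 1 - \<delta> / 2"
    and sep: "\<And>k l. k \<in> K' \<Longrightarrow> l \<in> K' \<Longrightarrow> k \<noteq> l \<Longrightarrow> Re (ix_inner I (\<sigma> k) (\<sigma> l)) \<le> \<delta> / 2"
    using mod by (auto simp: approx_rep_def I_def simp del: carrier_product_group mult_product_group)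
  define \<Theta> where "\<Theta> = (\<lambda>(g, h). ix_block (\<tau> h) (\<lambda>f. \<sigma> (shift g f)))"
  have Re_le: "Re (ix_inner I u v) \<le> 1" "- 1 \<le> Re (ix_inner I u v)" if "isometric I u" "isometric I v" for u v
    using norm_ix_inner_le_1[OF I that] abs_Re_le_cmod[of "ix_inner I u v"] by auto
  have iso_\<Theta>: "isometric (F \<times> I) (\<Theta> p)" if "p \<in> carrier ?W" for p
  proof -
    obtain g h where p: "p = (g, h)" by (cases p)
    then have c: "g \<in> carrier ?N" "h \<in> carrier H"
      using that by (simp_all add: unrestricted_wreath_def)
    show ?thesis
      unfolding \<Theta>_def p prod.case
      using isometric_ix_block[OF F(1) \<tau>[OF c(2)] iso[OF shift[OF c(1) Fc]]] .
  qed
  have bad2: "real (card ({f \<in> F. h \<otimes>\<^bsub>H\<^esub> f \<notin> F} \<union> {f \<in> F. h' \<otimes>\<^bsub>H\<^esub> f \<notin> F})) \<le> \<delta> / 4 * real (card F)"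
    if "h \<in> S" "h' \<in> S" for h h'
  proof -
    have "real (card ({f \<in> F. h \<otimes>\<^bsub>H\<^esub> f \<notin> F} \<union> {f \<in> F. h' \<otimes>\<^bsub>H\<^esub> f \<notin> F}))
        \<le> real (card {f \<in> F. h \<otimes>\<^bsub>H\<^esub> f \<notin> F}) + real (card {f \<in> F. h' \<otimes>\<^bsub>H\<^esub> f \<notin> F})"
      unfolding of_nat_add[symmetric] of_nat_le_iff by (rule card_Un_le)
    then show ?thesis
      using folner[OF that(1)] folner[OF that(2)] by linarith
  qed
  have mult_\<Theta>: "Re (ix_inner (F \<times> I) (ix_mult (F \<times> I) (\<Theta> (g, h)) (\<Theta> (g', h'))) (\<Theta> ((g, h) \<otimes>\<^bsub>?W\<^esub> (g', h')))) \<ge> 1 - \<delta>"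
    if kl: "(g, h) \<in> K" "(g', h') \<in> K" for g h g' h'
  proof -
    note c = Kc[OF kl(1)] Kc[OF kl(2)]
    define g'' where "g'' = (\<lambda>x\<in>carrier H. g (h' \<otimes>\<^bsub>H\<^esub> x) \<otimes>\<^bsub>G\<^esub> g' x)"
    have prod: "(g, h) \<otimes>\<^bsub>?W\<^esub> (g', h') = (g'', h \<otimes>\<^bsub>H\<^esub> h')"
      by (simp add: unrestricted_wreath_def g''_def)
    have g'': "g'' \<in> carrier ?N"
      using c by (auto simp: g''_def PiE_iff)
    have shift'': "shift g'' f = shift g (h' \<otimes>\<^bsub>H\<^esub> f) \<otimes>\<^bsub>?N\<^esub> shift g' f" if "f \<in> F" for f
      using c Fc[OF that] by (auto simp: shift_def g''_def H.m_assoc intro!: restrict_ext)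
    define v where "v = (\<lambda>f. if \<tau> h (\<tau> h' f) = \<tau> (h \<otimes>\<^bsub>H\<^esub> h') f then
        ix_inner I (ix_mult I (\<sigma> (shift g (\<tau> h' f))) (\<sigma> (shift g' f))) (\<sigma> (shift g'' f)) else 0)"
    have "ix_inner (F \<times> I) (ix_mult (F \<times> I) (\<Theta> (g, h)) (\<Theta> (g', h'))) (\<Theta> (g'', h \<otimes>\<^bsub>H\<^esub> h'))
      = ix_inner (F \<times> I) (ix_block (\<tau> h \<circ> \<tau> h') (\<lambda>f. ix_mult I (\<sigma> (shift g (\<tau> h' f))) (\<sigma> (shift g' f))))
          (\<Theta> (g'', h \<otimes>\<^bsub>H\<^esub> h'))"
      unfolding \<Theta>_def using F(1) \<tau>_mem c by (intro ix_inner_cong) (auto simp: ix_mult_ix_block)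
    also have "\<dots> = (\<Sum>f\<in>F. v f) / of_nat (card F)"
      unfolding \<Theta>_def prod.case v_def using F(1) \<tau>_mem c by (subst ix_inner_ix_block) auto
    finally have eq: "Re (ix_inner (F \<times> I) (ix_mult (F \<times> I) (\<Theta> (g, h)) (\<Theta> (g', h'))) (\<Theta> (g'', h \<otimes>\<^bsub>H\<^esub> h')))
        = (\<Sum>f\<in>F. Re (v f)) / real (card F)"
      by (simp only: Re_divide_of_nat Re_sum)
    \<comment> \<open>Outside \<open>B\<close> the permutations agree with the translations by \<open>h'\<close>, \<open>h\<close> and \<open>hh'\<close> along
      \<open>f \<mapsto> h'f \<mapsto> hh'f\<close>; on \<open>B\<close> the inner product may drop from 1 to \<open>-1\<close>, a loss of 2.\<close>
    define B where "B = {f \<in> F. h' \<otimes>\<^bsub>H\<^esub> f \<notin> F} \<union> {f \<in> F. h \<otimes>\<^bsub>H\<^esub> h' \<otimes>\<^bsub>H\<^esub> f \<notin> F}"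
    have "(\<Sum>f\<in>F. - Re (v f)) / real (card F) \<le> - (1 - \<delta> / 2) + 2 * (\<delta> / 4)"
    proof (rule average_le[OF F(1,2)])
      show "real (card B) \<le> \<delta> / 4 * real (card F)"
        unfolding B_def using SI SI2 kl by (intro bad2) auto
      fix f assume f: "f \<in> F"
      show "- Re (v f) \<le> - (1 - \<delta> / 2) + (if f \<in> B then 2 else 0)"
      proof (cases "f \<in> B")
        case True
        have "- 1 \<le> Re (v f)"
          unfolding v_def using f c \<tau>_mem Fc g'' I(1)
          by (auto intro!: Re_le isometric_ix_mult iso shift simp del: carrier_product_group)
        then show ?thesis using True \<open>\<delta> > 0\<close> by simp
      next
        case False
        then have f': "h' \<otimes>\<^bsub>H\<^esub> f \<in> F" "h \<otimes>\<^bsub>H\<^esub> h' \<otimes>\<^bsub>H\<^esub> f \<in> F"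
          using f by (auto simp: B_def)
        have "\<tau> h' f = h' \<otimes>\<^bsub>H\<^esub> f" "\<tau> (h \<otimes>\<^bsub>H\<^esub> h') f = h \<otimes>\<^bsub>H\<^esub> h' \<otimes>\<^bsub>H\<^esub> f"
          "\<tau> h (h' \<otimes>\<^bsub>H\<^esub> f) = h \<otimes>\<^bsub>H\<^esub> h' \<otimes>\<^bsub>H\<^esub> f"
          using f f' c Fc[OF f] by (auto simp: \<tau>_eq H.m_assoc)
        then have "v f = ix_inner I (ix_mult I (\<sigma> (shift g (h' \<otimes>\<^bsub>H\<^esub> f))) (\<sigma> (shift g' f)))
            (\<sigma> (shift g (h' \<otimes>\<^bsub>H\<^esub> f) \<otimes>\<^bsub>?N\<^esub> shift g' f))"
          unfolding v_def shift''[OF f, symmetric] by simp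
        then have "Re (v f) \<ge> 1 - \<delta> / 2"
          using mult[OF K'_mem[OF kl(1) f'(1)] K'_mem[OF kl(2) f]] by simp
        then show ?thesis using False by simp
      qed
    qed (auto simp: B_def)
    then show ?thesis
      unfolding prod eq by (simp add: sum_negf)
  qed
  have sep_\<Theta>: "Re (ix_inner (F \<times> I) (\<Theta> (g, h)) (\<Theta> (g', h'))) \<le> \<delta>"
    if kl: "(g, h) \<in> K" "(g', h') \<in> K" "(g, h) \<noteq> (g', h')" for g h g' h'
  proof -
    note c = Kc[OF kl(1)] Kc[OF kl(2)]
    define v where "v = (\<lambda>f. if \<tau> h f = \<tau> h' f then ix_inner I (\<sigma> (shift g f)) (\<sigma> (shift g' f)) else 0)"
    have "ix_inner (F \<times> I) (\<Theta> (g, h)) (\<Theta> (g', h')) = (\<Sum>f\<in>F. v f) / of_nat (card F)"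
      unfolding \<Theta>_def prod.case v_def using F(1) \<tau>_mem c by (subst ix_inner_ix_block) auto
    then have eq: "Re (ix_inner (F \<times> I) (\<Theta> (g, h)) (\<Theta> (g', h'))) = (\<Sum>f\<in>F. Re (v f)) / real (card F)"
      by (simp only: Re_divide_of_nat Re_sum)
    show ?thesis
    proof (cases "h = h'")
      case True
      have "Re (v f) \<le> \<delta> / 2" if f: "f \<in> F" for f
      proof -
        have "g \<noteq> g'" using kl(3) True by simp
        then obtain x where x: "x \<in> carrier H" "g x \<noteq> g' x"
          using c PiE_ext[of g "carrier H" "\<lambda>_. carrier G" g'] by auto
        have "f \<otimes>\<^bsub>H\<^esub> (inv\<^bsub>H\<^esub> f \<otimes>\<^bsub>H\<^esub> x) = x"
          using Fc[OF f] x by (simp add: H.m_assoc[symmetric])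
        then have "shift g f (inv\<^bsub>H\<^esub> f \<otimes>\<^bsub>H\<^esub> x) \<noteq> shift g' f (inv\<^bsub>H\<^esub> f \<otimes>\<^bsub>H\<^esub> x)"
          using Fc[OF f] x by (simp add: shift_def)
        then have "shift g f \<noteq> shift g' f" by metis
        then show ?thesis
          using sep[OF K'_mem[OF kl(1) f] K'_mem[OF kl(2) f]] True by (simp add: v_def)
      qed
      then have "(\<Sum>f\<in>F. Re (v f)) / real (card F) \<le> \<delta> / 2 + 0 * 0"
        using \<open>\<delta> > 0\<close> by (intro average_le[OF F(1,2), of "{}"]) auto
      then show ?thesis unfolding eq using \<open>\<delta> > 0\<close> by linarith
    next
      case False
      \<comment> \<open>Outside \<open>B\<close> the blocks sit in the different positions \<open>hf\<close> and \<open>h'f\<close>.\<close>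
      define B where "B = {f \<in> F. h \<otimes>\<^bsub>H\<^esub> f \<notin> F} \<union> {f \<in> F. h' \<otimes>\<^bsub>H\<^esub> f \<notin> F}"
      have "(\<Sum>f\<in>F. Re (v f)) / real (card F) \<le> 0 + 1 * (\<delta> / 4)"
      proof (rule average_le[OF F(1,2)])
        show "real (card B) \<le> \<delta> / 4 * real (card F)"
          unfolding B_def using SI kl by (intro bad2) auto
        fix f assume f: "f \<in> F"
        show "Re (v f) \<le> 0 + (if f \<in> B then 1 else 0)"
        proof (cases "f \<in> B")
          case True
          have "Re (ix_inner I (\<sigma> (shift g f)) (\<sigma> (shift g' f))) \<le> 1"
            by (intro Re_le(1) iso shift c(1,3) Fc f)
          then show ?thesis
            using True by (simp add: v_def)
        next
          case False
          then have "\<tau> h f = h \<otimes>\<^bsub>H\<^esub> f" "\<tau> h' f = h' \<otimes>\<^bsub>H\<^esub> f"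
            using f c by (auto simp: B_def \<tau>_eq)
          then have "\<tau> h f \<noteq> \<tau> h' f"
            using \<open>h \<noteq> h'\<close> c Fc[OF f] by simp
          then show ?thesis by (simp add: v_def)
        qed
      qed (auto simp: B_def)
      then show ?thesis unfolding eq using \<open>\<delta> > 0\<close> by linarith
    qed
  qed
  have "approx_rep ?W K \<delta> (F \<times> I) \<Theta>"
    unfolding approx_rep_def
  proof (intro conjI ballI impI)
    fix p q assume pq: "p \<in> K" "q \<in> K"
    then show "Re (ix_inner (F \<times> I) (ix_mult (F \<times> I) (\<Theta> p) (\<Theta> q)) (\<Theta> (p \<otimes>\<^bsub>?W\<^esub> q))) \<ge> 1 - \<delta>"
      using mult_\<Theta>[of "fst p" "snd p" "fst q" "snd q"] by simp
    assume "p \<noteq> q"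
    with pq show "Re (ix_inner (F \<times> I) (\<Theta> p) (\<Theta> q)) \<le> \<delta>"
      using sep_\<Theta>[of "fst p" "snd p" "fst q" "snd q"] by (simp add: prod_eq_iff)
  qed (use F(1,2) I iso_\<Theta> in auto)
  then show "\<exists>(I :: ('b \<times> nat) set) \<theta>. approx_rep ?W K \<delta> I \<theta>"
    by blast
qed

end
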